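(* Let $R$ be a $\sigma$-Euclidean ring. Every invertible right ideal of $R$ that is generated by two elements $a,b$ such that $a\sigma(b)\in R^+$ is principal.
   Context: Rings are unital. An involution on a ring $R$ is an additive map $\sigma:R\to R$ with $\sigma(xy)=\sigma(y)\sigma(x)$ and $\sigma(\sigma(x))=x$ for all $x,y$; write $R^+=\{r\in R\mid\sigma(r)=r\}$. A ring with involution $(R,\sigma)$ without zero divisors is $\sigma$-Euclidean if there exist a well-ordered set $W$ and a function $\Phi:R\to W$ such that for all $a,b\in R$ with $b\neq0$ and $a\sigma(b)\in R^+$ there exists $q\in R^+$ with $\Phi(a-bq)<\Phi(b)$. The right ideal generated by $a,b$ is $aR+bR$; a right ideal is principal if it equals $gR$ for some $g\in R$. A right ideal $I$ is called invertible if it is a finitely generated projective generator as a right $R$-module (for orders in quaternion algebras this is the usual notion of invertible right ideal). *)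

theory Defs
  imports "HOL-Algebra.Algebra"
begin

section \<open>Rings with involution and sigma-Euclidean rings\<close>

locale ring_involution = ring R for R (structure) and \<sigma> +
  assumes inv_closed: "x \<in> carrier R \<Longrightarrow> \<sigma> x \<in> carrier R"
    and inv_add: "\<lbrakk>x \<in> carrier R; y \<in> carrier R\<rbrakk> \<Longrightarrow> \<sigma> (x \<oplus> y) = \<sigma> x \<oplus> \<sigma> y"
    and inv_mult: "\<lbrakk>x \<in> carrier R; y \<in> carrier R\<rbrakk> \<Longrightarrow> \<sigma> (x \<otimes> y) = \<sigma> y \<otimes> \<sigma> x"
    and inv_inv: "x \<in> carrier R \<Longrightarrow> \<sigma> (\<sigma> x) = x"

definition symmetric_elements :: "('a, 'b) ring_scheme \<Rightarrow> ('a \<Rightarrow> 'a) \<Rightarrow> 'a set" where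
  "symmetric_elements R \<sigma> = {r \<in> carrier R. \<sigma> r = r}"

definition no_zero_divisors_ring :: "('a, 'b) ring_scheme \<Rightarrow> bool" where
  "no_zero_divisors_ring R \<longleftrightarrow>
     (\<forall>x \<in> carrier R. \<forall>y \<in> carrier R. x \<otimes>\<^bsub>R\<^esub> y = \<zero>\<^bsub>R\<^esub> \<longrightarrow> x = \<zero>\<^bsub>R\<^esub> \<or> y = \<zero>\<^bsub>R\<^esub>)"

text \<open>The well-ordered set is \<open>W\<close> with the (reflexive) relation \<open>r\<close>; \<open>r - Id\<close> is the strict
  order. HOL cannot quantify existentially over the type \<open>'w\<close> in which \<open>W\<close> lives, so that type
  is a parameter; as the predicate is used as a hypothesis with \<open>'w\<close> free in the theorem, this
  amounts to allowing an arbitrary well-ordered set.\<close>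

definition sigma_euclidean ::
    "'w itself \<Rightarrow> ('a, 'b) ring_scheme \<Rightarrow> ('a \<Rightarrow> 'a) \<Rightarrow> bool" where
  "sigma_euclidean _ R \<sigma> \<longleftrightarrow>
     ring_involution R \<sigma> \<and> no_zero_divisors_ring R \<and>
     (\<exists>(W :: 'w set) r \<Phi>. well_order_on W r \<and> \<Phi> \<in> carrier R \<rightarrow> W \<and>
        (\<forall>a \<in> carrier R. \<forall>b \<in> carrier R.
           b \<noteq> \<zero>\<^bsub>R\<^esub> \<and> a \<otimes>\<^bsub>R\<^esub> \<sigma> b \<in> symmetric_elements R \<sigma> \<longrightarrow>
           (\<exists>q \<in> symmetric_elements R \<sigma>. (\<Phi> (a \<ominus>\<^bsub>R\<^esub> b \<otimes>\<^bsub>R\<^esub> q), \<Phi> b) \<in> r - Id)))"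


section \<open>Right modules over noncommutative rings\<close>

text \<open>The library locale \<^locale>\<open>module\<close> is about modules over commutative rings. Its record type is
  reused here: \<open>a \<odot>\<^bsub>M\<^esub> x\<close> denotes the right action \<open>x \<cdot> a\<close>, whence the order of the factors in
  the associativity law.\<close>

locale right_module = R?: ring R + M?: abelian_group M
    for R :: "('a, 'b) ring_scheme" (structure) and M :: "('a, 'm, 'c) module_scheme" (structure) +
  assumes smult_closed:
      "\<lbrakk>a \<in> carrier R; x \<in> carrier M\<rbrakk> \<Longrightarrow> a \<odot>\<^bsub>M\<^esub> x \<in> carrier M"
    and smult_l_distr:
      "\<lbrakk>a \<in> carrier R; b \<in> carrier R; x \<in> carrier M\<rbrakk> \<Longrightarrow>
        (a \<oplus> b) \<odot>\<^bsub>M\<^esub> x = a \<odot>\<^bsub>M\<^esub> x \<oplus>\<^bsub>M\<^esub> b \<odot>\<^bsub>M\<^esub> x"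
    and smult_r_distr:
      "\<lbrakk>a \<in> carrier R; x \<in> carrier M; y \<in> carrier M\<rbrakk> \<Longrightarrow>
        a \<odot>\<^bsub>M\<^esub> (x \<oplus>\<^bsub>M\<^esub> y) = a \<odot>\<^bsub>M\<^esub> x \<oplus>\<^bsub>M\<^esub> a \<odot>\<^bsub>M\<^esub> y"
    and smult_assoc:
      "\<lbrakk>a \<in> carrier R; b \<in> carrier R; x \<in> carrier M\<rbrakk> \<Longrightarrow>
        (a \<otimes> b) \<odot>\<^bsub>M\<^esub> x = b \<odot>\<^bsub>M\<^esub> (a \<odot>\<^bsub>M\<^esub> x)"
    and smult_one:
      "x \<in> carrier M \<Longrightarrow> \<one> \<odot>\<^bsub>M\<^esub> x = x"

definition right_module_hom ::
    "('a, 'b) ring_scheme \<Rightarrow> ('a, 'm) module \<Rightarrow> ('a, 'n) module \<Rightarrow> ('m \<Rightarrow> 'n) set" where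
  "right_module_hom R M N =
     {f \<in> carrier M \<rightarrow> carrier N.
        (\<forall>x \<in> carrier M. \<forall>y \<in> carrier M. f (x \<oplus>\<^bsub>M\<^esub> y) = f x \<oplus>\<^bsub>N\<^esub> f y) \<and>
        (\<forall>a \<in> carrier R. \<forall>x \<in> carrier M. f (a \<odot>\<^bsub>M\<^esub> x) = a \<odot>\<^bsub>N\<^esub> f x)}"

text \<open>The locale \<^locale>\<open>submodule\<close> needs neither commutativity nor sidedness.\<close>

definition finitely_generated_module :: "('a, 'b) ring_scheme \<Rightarrow> ('a, 'm) module \<Rightarrow> bool" where
  "finitely_generated_module R P \<longleftrightarrow>
     (\<exists>S. finite S \<and> S \<subseteq> carrier P \<and> (\<forall>N. submodule N R P \<and> S \<subseteq> N \<longrightarrow> N = carrier P))"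

text \<open>Projectivity is the lifting property against all epimorphisms \<open>M \<rightarrow> N\<close>. A definition in HOL
  has to name the types in which \<open>M\<close> and \<open>N\<close> live; those chosen lose nothing: taking \<open>N = P\<close> and
  for \<open>M\<close> the free module on \<open>carrier P\<close> (finitely supported functions of type \<open>'m \<Rightarrow> 'a\<close>),
  lifting the identity exhibits \<open>P\<close> as a direct summand of a free module, which yields lifting
  against every epimorphism, at any types.\<close>

definition projective_module :: "('a, 'b) ring_scheme \<Rightarrow> ('a, 'm) module \<Rightarrow> bool" where
  "projective_module R P \<longleftrightarrow>
     (\<forall>(M :: ('a, 'm \<Rightarrow> 'a) module) (N :: ('a, 'm) module).
        right_module R M \<and> right_module R N \<longrightarrow>
        (\<forall>f \<in> right_module_hom R M N. \<forall>g \<in> right_module_hom R P N.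
           f ` carrier M = carrier N \<longrightarrow>
           (\<exists>h \<in> right_module_hom R P M. \<forall>x \<in> carrier P. f (h x) = g x)))"

text \<open>\<open>P\<close> is a generator if the functor \<open>Hom(P, -)\<close> is faithful. Again the types lose nothing. Let
  \<open>T\<close> be the trace ideal, the sum of the images of all homomorphisms \<open>P \<rightarrow> R\<close>. Testing the
  projection and the zero map from \<open>R\<close> to \<open>R/T\<close> (whose elements are cosets, of type \<open>'a set\<close>)
  gives \<open>T = R\<close>, and this implies faithfulness on modules of any types.\<close>

definition generator_module :: "('a, 'b) ring_scheme \<Rightarrow> ('a, 'm) module \<Rightarrow> bool" where
  "generator_module R P \<longleftrightarrow>
     (\<forall>(M :: ('a, 'a) module) (N :: ('a, 'a set) module).
        right_module R M \<and> right_module R N \<longrightarrow>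
        (\<forall>f \<in> right_module_hom R M N. \<forall>g \<in> right_module_hom R M N.
           (\<forall>h \<in> right_module_hom R P M. \<forall>x \<in> carrier P. f (h x) = g (h x)) \<longrightarrow>
           (\<forall>y \<in> carrier M. f y = g y)))"


section \<open>Right ideals\<close>

locale right_ideal = additive_subgroup I R + ring R for I and R (structure) +
  assumes I_r_closed: "\<lbrakk>x \<in> I; r \<in> carrier R\<rbrakk> \<Longrightarrow> x \<otimes> r \<in> I"

text \<open>A right ideal viewed as a right module. The fields \<open>mult\<close> and \<open>one\<close> come with the record type
  and play no role.\<close>

definition right_ideal_module :: "('a, 'b) ring_scheme \<Rightarrow> 'a set \<Rightarrow> ('a, 'a) module" where
  "right_ideal_module R I =
     \<lparr>carrier = I, monoid.mult = monoid.mult R, one = \<one>\<^bsub>R\<^esub>,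
      ring.zero = \<zero>\<^bsub>R\<^esub>, ring.add = ring.add R,
      smult = (\<lambda>r x. x \<otimes>\<^bsub>R\<^esub> r)\<rparr>"

definition invertible_right_ideal :: "'a set \<Rightarrow> ('a, 'b) ring_scheme \<Rightarrow> bool" where
  "invertible_right_ideal I R \<longleftrightarrow>
     right_ideal I R \<and>
     finitely_generated_module R (right_ideal_module R I) \<and>
     projective_module R (right_ideal_module R I) \<and>
     generator_module R (right_ideal_module R I)"

definition principal_right_ideal :: "'a set \<Rightarrow> ('a, 'b) ring_scheme \<Rightarrow> bool" where
  "principal_right_ideal I R \<longleftrightarrow> (\<exists>g \<in> carrier R. I = g <#\<^bsub>R\<^esub> carrier R)"

end

theory Submission
  imports Defs
begin

text \<open>The reason is the Euclidean algorithm. If \<open>a \<sigma>(b)\<close> is symmetric and \<open>b \<noteq> 0\<close>, division gives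
  a symmetric \<open>q\<close> such that \<open>r = a - bq\<close> satisfies \<open>\<Phi>(r) < \<Phi>(b)\<close>. Since \<open>b q \<sigma>(b)\<close> is symmetric,
  so is \<open>r \<sigma>(b) = a \<sigma>(b) - b q \<sigma>(b)\<close>; as an element fixed by \<open>\<sigma>\<close>, it equals \<open>b \<sigma>(r)\<close>.
  Thus the pair \<open>(b, r)\<close> again satisfies the symmetry condition
  (\<open>remainder_symmetric\<close>), and it generates the same right ideal as \<open>(a, b)\<close>
  (\<open>right_ideal_sum_remainder\<close>). Well-foundedness forces the process to stop, which it
  can only do at a pair \<open>(g, 0)\<close>, where the right ideal is \<open>gR\<close>.\<close>

lemma (in ring) right_ideal_sum_eq:
  "(a <#\<^bsub>R\<^esub> carrier R) <+>\<^bsub>R\<^esub> (b <#\<^bsub>R\<^esub> carrier R) =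
     {a \<otimes> x \<oplus> b \<otimes> y | x y. x \<in> carrier R \<and> y \<in> carrier R}"
  by (auto simp: set_add_def' l_coset_def)

lemma (in ring) right_ideal_sumI:
  assumes "z = a \<otimes> x \<oplus> b \<otimes> y" "x \<in> carrier R" "y \<in> carrier R"
  shows "z \<in> (a <#\<^bsub>R\<^esub> carrier R) <+>\<^bsub>R\<^esub> (b <#\<^bsub>R\<^esub> carrier R)"
  using assms unfolding right_ideal_sum_eq by blast

lemma (in ring) right_ideal_sum_remainder:
  assumes [simp]: "a \<in> carrier R" "b \<in> carrier R" "q \<in> carrier R"
  shows "(a <#\<^bsub>R\<^esub> carrier R) <+>\<^bsub>R\<^esub> (b <#\<^bsub>R\<^esub> carrier R) =
         (b <#\<^bsub>R\<^esub> carrier R) <+>\<^bsub>R\<^esub> ((a \<ominus> b \<otimes> q) <#\<^bsub>R\<^esub> carrier R)"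
proof (intro equalityI subsetI)
  define r where "r = a \<ominus> b \<otimes> q"
  have [simp]: "r \<in> carrier R"
    by (simp add: r_def)
  have a: "a = r \<oplus> b \<otimes> q"
    by (simp add: r_def minus_eq a_assoc l_neg)
  {
    fix z assume "z \<in> (a <#\<^bsub>R\<^esub> carrier R) <+>\<^bsub>R\<^esub> (b <#\<^bsub>R\<^esub> carrier R)"
    then obtain x y where xy [simp]: "x \<in> carrier R" "y \<in> carrier R"
      and z: "z = a \<otimes> x \<oplus> b \<otimes> y"
      by (auto simp: right_ideal_sum_eq)
    have z': "z = b \<otimes> (y \<oplus> q \<otimes> x) \<oplus> r \<otimes> x"
      unfolding z a by (simp add: l_distr r_distr m_assoc a_ac)
    have c: "y \<oplus> q \<otimes> x \<in> carrier R"
      by simp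
    show "z \<in> (b <#\<^bsub>R\<^esub> carrier R) <+>\<^bsub>R\<^esub> ((a \<ominus> b \<otimes> q) <#\<^bsub>R\<^esub> carrier R)"
      by (rule right_ideal_sumI [OF z' c xy(1), unfolded r_def])
  next
    fix z assume "z \<in> (b <#\<^bsub>R\<^esub> carrier R) <+>\<^bsub>R\<^esub> ((a \<ominus> b \<otimes> q) <#\<^bsub>R\<^esub> carrier R)"
    then obtain x y where xy [simp]: "x \<in> carrier R" "y \<in> carrier R"
      and z: "z = b \<otimes> x \<oplus> r \<otimes> y"
      by (auto simp: right_ideal_sum_eq r_def)
    have z': "z = a \<otimes> y \<oplus> b \<otimes> (x \<ominus> q \<otimes> y)"
      unfolding z a by (simp add: l_distr r_distr m_assoc minus_eq r_minus r_neg a_ac)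
    have c: "x \<ominus> q \<otimes> y \<in> carrier R"
      by simp
    show "z \<in> (a <#\<^bsub>R\<^esub> carrier R) <+>\<^bsub>R\<^esub> (b <#\<^bsub>R\<^esub> carrier R)"
      by (rule right_ideal_sumI [OF z' xy(2) c])
  }
qed

lemma (in ring) right_ideal_sum_zero:
  assumes "a \<in> carrier R"
  shows "(a <#\<^bsub>R\<^esub> carrier R) <+>\<^bsub>R\<^esub> (\<zero> <#\<^bsub>R\<^esub> carrier R) = a <#\<^bsub>R\<^esub> carrier R"
proof -
  have "\<zero> <#\<^bsub>R\<^esub> carrier R = {\<zero>}"
    by (auto simp: l_coset_def)
  then show ?thesis
    using assms by (auto simp: set_add_def' l_coset_def)
qed

lemma (in ring_involution) remainder_symmetric:
  assumes [simp]: "a \<in> carrier R" "b \<in> carrier R"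
    and ab: "a \<otimes> \<sigma> b \<in> symmetric_elements R \<sigma>"
    and q: "q \<in> symmetric_elements R \<sigma>"
  shows "b \<otimes> \<sigma> (a \<ominus> b \<otimes> q) \<in> symmetric_elements R \<sigma>"
proof -
  have [simp]: "q \<in> carrier R" "\<sigma> q = q" "\<sigma> a \<in> carrier R" "\<sigma> b \<in> carrier R"
    using q by (auto simp: symmetric_elements_def inv_closed)
  define r where "r = a \<ominus> b \<otimes> q"
  have r [simp]: "r \<in> carrier R" "\<sigma> r \<in> carrier R"
    by (simp_all add: r_def inv_closed)
  have a: "a = r \<oplus> b \<otimes> q"
    by (simp add: r_def minus_eq a_assoc l_neg)
  have "b \<otimes> \<sigma> r \<oplus> b \<otimes> (q \<otimes> \<sigma> b) = b \<otimes> \<sigma> a"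
    unfolding a by (simp add: inv_add inv_mult r_distr)
  also have "\<dots> = a \<otimes> \<sigma> b"
    using ab by (simp add: symmetric_elements_def inv_mult inv_inv)
  also have "\<dots> = r \<otimes> \<sigma> b \<oplus> b \<otimes> (q \<otimes> \<sigma> b)"
    unfolding a by (simp add: l_distr m_assoc)
  finally have "b \<otimes> \<sigma> r = r \<otimes> \<sigma> b"
    by simp
  then show ?thesis
    by (simp add: symmetric_elements_def inv_mult inv_inv flip: r_def)
qed

theorem corollary2p1:
  fixes R :: "('a, 'b) ring_scheme"
    and \<sigma> :: "'a \<Rightarrow> 'a"
    and I :: "'a set"
    and a b :: 'a
  assumes "sigma_euclidean TYPE('w) R \<sigma>"
    and "invertible_right_ideal I R"
    and "a \<in> carrier R" and "b \<in> carrier R"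
    and "a \<otimes>\<^bsub>R\<^esub> \<sigma> b \<in> symmetric_elements R \<sigma>"
    and "I = (a <#\<^bsub>R\<^esub> carrier R) <+>\<^bsub>R\<^esub> (b <#\<^bsub>R\<^esub> carrier R)"
  shows "principal_right_ideal I R"
proof -
  interpret ring_involution R \<sigma>
    using assms(1) by (simp add: sigma_euclidean_def)
  obtain W :: "'w set" and r \<Phi> where wo: "well_order_on W r"
    and division: "\<And>a b. \<lbrakk>a \<in> carrier R; b \<in> carrier R; b \<noteq> \<zero>\<^bsub>R\<^esub>;
        a \<otimes>\<^bsub>R\<^esub> \<sigma> b \<in> symmetric_elements R \<sigma>\<rbrakk> \<Longrightarrow>
        \<exists>q \<in> symmetric_elements R \<sigma>. (\<Phi> (a \<ominus>\<^bsub>R\<^esub> b \<otimes>\<^bsub>R\<^esub> q), \<Phi> b) \<in> r - Id"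
    using assms(1) unfolding sigma_euclidean_def by blast
  have "wf (inv_image (r - Id) \<Phi>)"
    using wo by (simp add: well_order_on_def)
  then show ?thesis
    using assms(3-6)
  proof (induction b arbitrary: a rule: wf_induct_rule)
    case (less b)
    show ?case
    proof (cases "b = \<zero>\<^bsub>R\<^esub>")
      case True
      then show ?thesis
        using less.prems right_ideal_sum_zero by (auto simp: principal_right_ideal_def)
    next
      case False
      then obtain q where q: "q \<in> symmetric_elements R \<sigma>"
        and lt: "(\<Phi> (a \<ominus>\<^bsub>R\<^esub> b \<otimes>\<^bsub>R\<^esub> q), \<Phi> b) \<in> r - Id"
        using division less.prems by blast
      have qc: "q \<in> carrier R"
        using q by (simp add: symmetric_elements_def)
      show ?thesis
      proof (rule less.IH)
        show "(a \<ominus>\<^bsub>R\<^esub> b \<otimes>\<^bsub>R\<^esub> q, b) \<in> inv_image (r - Id) \<Phi>"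
          using lt by simp
        show "b \<otimes>\<^bsub>R\<^esub> \<sigma> (a \<ominus>\<^bsub>R\<^esub> b \<otimes>\<^bsub>R\<^esub> q) \<in> symmetric_elements R \<sigma>"
          using remainder_symmetric less.prems q by blast
        show "I = (b <#\<^bsub>R\<^esub> carrier R) <+>\<^bsub>R\<^esub> ((a \<ominus>\<^bsub>R\<^esub> b \<otimes>\<^bsub>R\<^esub> q) <#\<^bsub>R\<^esub> carrier R)"
          unfolding less.prems(4) using less.prems(1,2) qc by (rule right_ideal_sum_remainder)
      qed (simp_all add: less.prems(1,2) qc)
    qed
  qed
qed

end
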